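(* Let $P$ be a program with finite sets of controlled inputs $\mathcal A$ and uncontrolled inputs $\mathcal X$, $O$ a set of finite traces (the target), $k$ a bound, and $Q$ a threshold. Let $P|^{\le k}$ denote the restriction of $P$ to traces of length at most $k$. Assume that the oracle used by QRSE+ always terminates with the exact answer. If $q(P|^{\le k},O)\ge Q$, then the algorithm QRSE+, run on $P$ with bound $k$, target $O$ and threshold $Q$, reports $O$ with a quantitative robustness $\chi$ satisfying $Q\le\chi\le q(P|^{\le k},O)$ (i.e. it returns $(\text{true},\chi)$ for such a $\chi$).
   Context: A program $P$ is a deterministic transition system: a set of states $\mathcal S$ with a transition relation $\to$ under which each state has at most one successor. An input of $P$ is a pair $(a,x)$ with $a\in\mathcal A$ (controlled input) and $x\in\mathcal X$ (uncontrolled input); $\mathcal A$ and $\mathcal X$ are nonempty and finite. Each input determines the initial state. A (finite) trace is a finite sequence of consecutive states respecting $\to$ starting from an initial state; $T(P)$ is the set of traces of $P$, and $T(P|_{(a,x)})$ is the set of traces of $P$ starting in the initial state determined by the input $(a,x)$. The length of a trace or path is its number of transitions, and $k$ is a nonnegative integer. Each state has an associated location in the source of the program; a path is a finite sequence of locations, and a trace follows the path given by the sequence of locations of its states; the paths of $P$ are the paths followed by traces of $P$. For paths $\pi_1,\dots,\pi_n$, the restriction $P|^{\pi_1,\dots,\pi_n}$ of $P$ to these paths has as traces on input $(a,x)$ exactly those traces in $T(P|_{(a,x)})$ which follow one of $\pi_1,\dots,\pi_n$. Similarly $P|^{\le k}$ has as traces on input $(a,x)$ exactly those traces in $T(P|_{(a,x)})$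 of length at most $k$. Quantitative robustness of a program $P'$ (either $P$ or one of its restrictions): $$q(P',O)=\frac1{|\mathcal X|}\max_{a\in\mathcal A}\left|\left\{x\in\mathcal X\mid T(P'|_{(a,x)})\cap O\neq\varnothing\right\}\right|.$$ Oracle: for paths $\pi_1,\dots,\pi_i$, the oracle applied to the merged path constraint (disjunction of the path constraints, where the path constraint of $\pi$ expresses which inputs $(a,x)$ make the program follow $\pi$ and reach $O$) returns $q(P|^{\pi_1,\dots,\pi_i},O)$. Algorithm QRSE+ (QRSE with path merging; bound $k$, target $O$, threshold $Q$): enumerate, in some order, all the paths $\pi_1,\pi_2,\dots$ of $P$ of length at most $k$; after enumerating $\pi_i$, compute with the oracle $\chi:=q(P|^{\pi_1,\dots,\pi_i},O)$ and, if $\chi\ge Q$, stop and return $(\text{true},\chi)$. If all paths have been enumerated without returning, return false. *)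

theory Defs
  imports Complex_Main
begin

section \<open>Programs, traces and paths\<close>

text \<open>\<open>Init P a x\<close> is only meaningful for \<open>a \<in> Ctrl P\<close> and \<open>x \<in> Unctrl P\<close>.\<close>

record ('a, 'x, 's, 'l) program =
  Ctrl :: "'a set"
  Unctrl :: "'x set"
  States :: "'s set"
  Trans :: "('s \<times> 's) set"
  Init :: "'a \<Rightarrow> 'x \<Rightarrow> 's"
  Loc :: "'s \<Rightarrow> 'l"

locale det_program =
  fixes P :: "('a, 'x, 's, 'l) program"
  assumes finite_Ctrl: "finite (Ctrl P)" and Ctrl_nonempty: "Ctrl P \<noteq> {}"
    and finite_Unctrl: "finite (Unctrl P)" and Unctrl_nonempty: "Unctrl P \<noteq> {}"
    and Trans_States: "Trans P \<subseteq> States P \<times> States P"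
    and Trans_deterministic: "single_valued (Trans P)"
    and Init_States: "\<And>a x. a \<in> Ctrl P \<Longrightarrow> x \<in> Unctrl P \<Longrightarrow> Init P a x \<in> States P"

text \<open>
  A trace is a nonempty list of states. A program and its restrictions have the same inputs and
  differ only in the traces they have on each input, so a restriction is represented by its family
  of trace sets, indexed by the inputs.
\<close>

type_synonym ('a, 'x, 's) trace_family = "'a \<Rightarrow> 'x \<Rightarrow> 's list set"

definition traces_on :: "('a, 'x, 's, 'l) program \<Rightarrow> ('a, 'x, 's) trace_family" where
  "traces_on P a x =
     {t. t \<noteq> [] \<and> hd t = Init P a x \<and> successively (\<lambda>s s'. (s, s') \<in> Trans P) t}"

definition traces :: "('a, 'x, 's, 'l) program \<Rightarrow> 's list set" where
  "traces P = (\<Union>a\<in>Ctrl P. \<Union>x\<in>Unctrl P. traces_on P a x)"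

text \<open>The length of a trace or path is its number of transitions.\<close>

definition num_trans :: "'b list \<Rightarrow> nat" where
  "num_trans t = length t - 1"

definition follows :: "('a, 'x, 's, 'l) program \<Rightarrow> 's list \<Rightarrow> 'l list \<Rightarrow> bool" where
  "follows P t \<pi> \<longleftrightarrow> map (Loc P) t = \<pi>"

definition paths :: "('a, 'x, 's, 'l) program \<Rightarrow> 'l list set" where
  "paths P = {\<pi>. \<exists>t\<in>traces P. follows P t \<pi>}"

definition restrict_paths ::
    "('a, 'x, 's, 'l) program \<Rightarrow> 'l list list \<Rightarrow> ('a, 'x, 's) trace_family" where
  "restrict_paths P \<pi>s a x = {t \<in> traces_on P a x. \<exists>\<pi>\<in>set \<pi>s. follows P t \<pi>}"

definition restrict_length ::
    "('a, 'x, 's, 'l) program \<Rightarrow> nat \<Rightarrow> ('a, 'x, 's) trace_family" where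
  "restrict_length P k a x = {t \<in> traces_on P a x. num_trans t \<le> k}"


section \<open>Quantitative robustness\<close>

definition quant_robustness ::
    "('a, 'x, 's, 'l) program \<Rightarrow> ('a, 'x, 's) trace_family \<Rightarrow> 's list set \<Rightarrow> real" where
  "quant_robustness P T Tgt =
     1 / real (card (Unctrl P)) *
     real (Max ((\<lambda>a. card {x \<in> Unctrl P. T a x \<inter> Tgt \<noteq> {}}) ` Ctrl P))"


section \<open>The algorithm\<close>

text \<open>Constraints on the inputs are represented by the sets of inputs that satisfy them.\<close>

definition path_constraint ::
    "('a, 'x, 's, 'l) program \<Rightarrow> 's list set \<Rightarrow> 'l list \<Rightarrow> ('a \<times> 'x) set" where
  "path_constraint P Tgt \<pi> =
     {(a, x). a \<in> Ctrl P \<and> x \<in> Unctrl P \<and> (\<exists>t\<in>traces_on P a x. follows P t \<pi> \<and> t \<in> Tgt)}"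

definition merged_constraint ::
    "('a, 'x, 's, 'l) program \<Rightarrow> 's list set \<Rightarrow> 'l list list \<Rightarrow> ('a \<times> 'x) set" where
  "merged_constraint P Tgt \<pi>s = (\<Union>\<pi>\<in>set \<pi>s. path_constraint P Tgt \<pi>)"

text \<open>\<open>None\<close> stands for an oracle call that gives no answer (for instance, does not terminate).\<close>

type_synonym ('a, 'x) robustness_oracle = "('a \<times> 'x) set \<Rightarrow> real option"

definition exact_oracle ::
    "('a, 'x, 's, 'l) program \<Rightarrow> 's list set \<Rightarrow> ('a, 'x) robustness_oracle \<Rightarrow> bool" where
  "exact_oracle P Tgt orc \<longleftrightarrow>
     (\<forall>\<pi>s. set \<pi>s \<subseteq> paths P \<longrightarrow>
        orc (merged_constraint P Tgt \<pi>s) =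
          Some (quant_robustness P (restrict_paths P \<pi>s) Tgt))"

text \<open>\<open>Robust \<chi>\<close> is the answer (true, \<open>\<chi>\<close>), \<open>Not_Robust\<close> is the answer false, and \<open>Stuck\<close> means
  that an oracle call gave no answer.\<close>

datatype qrse_result = Robust real | Not_Robust | Stuck

text \<open>The first list contains the paths enumerated so far, the second one those still to come.\<close>

fun qrse_plus_loop ::
    "('a, 'x, 's, 'l) program \<Rightarrow> ('a, 'x) robustness_oracle \<Rightarrow> 's list set \<Rightarrow> real \<Rightarrow>
     'l list list \<Rightarrow> 'l list list \<Rightarrow> qrse_result" where
  "qrse_plus_loop P orc Tgt Q seen [] = Not_Robust"
| "qrse_plus_loop P orc Tgt Q seen (\<pi> # \<pi>s) =
     (case orc (merged_constraint P Tgt (seen @ [\<pi>])) of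
        None \<Rightarrow> Stuck
      | Some \<chi> \<Rightarrow>
          if \<chi> \<ge> Q then Robust \<chi> else qrse_plus_loop P orc Tgt Q (seen @ [\<pi>]) \<pi>s)"

definition enumerates_paths ::
    "('a, 'x, 's, 'l) program \<Rightarrow> nat \<Rightarrow> 'l list list \<Rightarrow> bool" where
  "enumerates_paths P k \<pi>s \<longleftrightarrow> distinct \<pi>s \<and> set \<pi>s = {\<pi> \<in> paths P. num_trans \<pi> \<le> k}"

text \<open>The order of enumeration is left open, so the algorithm is a relation between its
  parameters and its possible results, one for each order.\<close>

definition qrse_plus ::
    "('a, 'x, 's, 'l) program \<Rightarrow> ('a, 'x) robustness_oracle \<Rightarrow> nat \<Rightarrow> 's list set \<Rightarrow> real \<Rightarrow>
     qrse_result \<Rightarrow> bool" where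
  "qrse_plus P orc k Tgt Q r \<longleftrightarrow>
     (\<exists>\<pi>s. enumerates_paths P k \<pi>s \<and> r = qrse_plus_loop P orc Tgt Q [] \<pi>s)"


section \<open>Enumerations and exact oracles exist\<close>

lemma successively_unique:
  assumes "single_valued R"
    and "successively (\<lambda>s s'. (s, s') \<in> R) t" "successively (\<lambda>s s'. (s, s') \<in> R) u"
    and "hd t = hd u" "length t = length u"
  shows "t = u"
  using assms(2-)
proof (induction t arbitrary: u)
  case (Cons s t)
  then obtain u' where u: "u = s # u'" by (cases u) auto
  have "hd t = hd u'" if "t \<noteq> []"
    using Cons.prems that u assms(1) by (cases t; cases u') (auto dest: single_valuedD)
  then show ?case
    using Cons.IH[of u'] Cons.prems u by (cases "t = []") (auto simp: successively_Cons)
qed simp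

lemma (in det_program) finite_bounded_paths: "finite {\<pi> \<in> paths P. num_trans \<pi> \<le> k}"
proof -
  have fin: "finite {t \<in> traces_on P a x. length t \<le> Suc k}" for a x
  proof (rule inj_on_finite[where f = length and B = "{..Suc k}"])
    show "inj_on length {t \<in> traces_on P a x. length t \<le> Suc k}"
      unfolding inj_on_def traces_on_def
      using successively_unique[OF Trans_deterministic] by force
  qed auto
  have "{\<pi> \<in> paths P. num_trans \<pi> \<le> k} \<subseteq>
    map (Loc P) ` (\<Union>a\<in>Ctrl P. \<Union>x\<in>Unctrl P. {t \<in> traces_on P a x. length t \<le> Suc k})"
    by (force simp: paths_def traces_def follows_def num_trans_def)
  then show ?thesis
    by (rule finite_subset) (use fin finite_Ctrl finite_Unctrl in auto)
qed

lemma (in det_program) ex_enumerates_paths: "\<exists>\<pi>s. enumerates_paths P k \<pi>s"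
  using finite_distinct_list[OF finite_bounded_paths] unfolding enumerates_paths_def by blast

lemma ex_exact_oracle: "\<exists>orc. exact_oracle P Tgt orc"
proof
  define orc where "orc C =
    Some (1 / real (card (Unctrl P)) *
      real (Max ((\<lambda>a. card {x \<in> Unctrl P. (a, x) \<in> C}) ` Ctrl P)))" for C
  have "{x \<in> Unctrl P. (a, x) \<in> merged_constraint P Tgt \<pi>s} =
      {x \<in> Unctrl P. restrict_paths P \<pi>s a x \<inter> Tgt \<noteq> {}}" if "a \<in> Ctrl P" for a \<pi>s
    using that by (auto simp: merged_constraint_def path_constraint_def restrict_paths_def)
  then show "exact_oracle P Tgt orc"
    by (simp add: exact_oracle_def orc_def quant_robustness_def cong: image_cong)
qed

end

theory Submission
  imports Defs
begin

text \<open>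
  Restricting \<open>P\<close> to all its paths of length at most \<open>k\<close> gives \<open>P|\<^sup>\<le>\<^sup>k\<close>, and robustness is monotone in
  the trace family. So every value computed by the loop is at most \<open>q(P|\<^sup>\<le>\<^sup>k, O)\<close>, and the value for
  the complete enumeration equals it, hence reaches the threshold. There is at least one path to
  enumerate, that of the trace consisting of an initial state.
\<close>

text \<open>For each fixed \<open>a\<close>, more traces can only enlarge the set of
  \<open>x\<close> that are counted, and the maximum over \<open>Ctrl P\<close> preserves
  this.\<close>

lemma (in det_program) quant_robustness_mono:
  assumes "\<And>a x. a \<in> Ctrl P \<Longrightarrow> x \<in> Unctrl P \<Longrightarrow> T a x \<subseteq> T' a x"
  shows "quant_robustness P T Tgt \<le> quant_robustness P T' Tgt"
proof -
  let ?n = "\<lambda>T a. card {x \<in> Unctrl P. T a x \<inter> Tgt \<noteq> {}}"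
  have "?n T a \<le> Max (?n T' ` Ctrl P)" if a: "a \<in> Ctrl P" for a
  proof -
    have "?n T a \<le> ?n T' a"
      using assms[OF a] finite_Unctrl by (intro card_mono) auto
    also have "\<dots> \<le> Max (?n T' ` Ctrl P)"
      using a finite_Ctrl by simp
    finally show ?thesis .
  qed
  then have "Max (?n T ` Ctrl P) \<le> Max (?n T' ` Ctrl P)"
    using finite_Ctrl Ctrl_nonempty by simp
  then show ?thesis
    unfolding quant_robustness_def by (intro mult_left_mono) auto
qed

text \<open>Following a path means mapping \<open>Loc\<close> over the trace, which preserves
  length.\<close>

lemma restrict_paths_subset_restrict_length:
  assumes "\<And>\<pi>. \<pi> \<in> set \<pi>s \<Longrightarrow> num_trans \<pi> \<le> k"
  shows "restrict_paths P \<pi>s a x \<subseteq> restrict_length P k a x"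
  using assms by (fastforce simp: restrict_paths_def restrict_length_def follows_def num_trans_def)

lemma restrict_length_subset_restrict_paths:
  assumes "enumerates_paths P k \<pi>s" "a \<in> Ctrl P" "x \<in> Unctrl P"
  shows "restrict_length P k a x \<subseteq> restrict_paths P \<pi>s a x"
proof
  fix t assume t: "t \<in> restrict_length P k a x"
  then have "map (Loc P) t \<in> set \<pi>s"
    using assms by (auto simp: enumerates_paths_def restrict_length_def paths_def traces_def
        follows_def num_trans_def)
  with t show "t \<in> restrict_paths P \<pi>s a x"
    by (simp add: restrict_length_def restrict_paths_def follows_def)
qed

text \<open>The loop answers \<open>Not_Robust\<close> on an empty list without consulting the
  oracle, which would be wrong for Q \<le> 0.\<close>

lemma (in det_program) enumeration_nonempty:
  assumes "enumerates_paths P k \<pi>s"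
  shows "\<pi>s \<noteq> []"
proof -
  obtain a x where "a \<in> Ctrl P" "x \<in> Unctrl P"
    using Ctrl_nonempty Unctrl_nonempty by blast
  \<comment> \<open>A one-state trace has 0 transitions, so it is within the bound even for k =
    0.\<close>
  moreover have "[Init P a x] \<in> restrict_length P k a x"
    by (simp add: restrict_length_def traces_on_def num_trans_def)
  ultimately have "[Init P a x] \<in> restrict_paths P \<pi>s a x"
    using restrict_length_subset_restrict_paths[OF assms] by blast
  then show ?thesis
    by (auto simp: restrict_paths_def)
qed

text \<open>Here \<open>ys\<close> is the list of paths merged when the loop stops. Its inclusion in
  the enumeration is all that the upper bound needs. An arbitrary \<open>seen\<close> makes the
  induction go through.\<close>

lemma qrse_plus_loop_Robust:
  assumes "exact_oracle P Tgt orc"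
    and "set (seen @ \<pi>s) \<subseteq> paths P" "\<pi>s \<noteq> []"
    and "Q \<le> quant_robustness P (restrict_paths P (seen @ \<pi>s)) Tgt"
  shows "\<exists>ys. set ys \<subseteq> set (seen @ \<pi>s) \<and>
    Q \<le> quant_robustness P (restrict_paths P ys) Tgt \<and>
    qrse_plus_loop P orc Tgt Q seen \<pi>s = Robust (quant_robustness P (restrict_paths P ys) Tgt)"
  using assms(2-)
proof (induction \<pi>s arbitrary: seen)
  case (Cons \<pi> \<pi>s)
  let ?q = "quant_robustness P (restrict_paths P (seen @ [\<pi>])) Tgt"
  have orc: "orc (merged_constraint P Tgt (seen @ [\<pi>])) = Some ?q"
    using assms(1) Cons.prems(1) unfolding exact_oracle_def by simp
  show ?case
  proof (cases "Q \<le> ?q")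
    case True
    with orc show ?thesis by (intro exI[of _ "seen @ [\<pi>]"]) auto
  next
    case False
    \<comment> \<open>If \<open>\<pi>\<close> were the last path, \<open>?q\<close> would be the
      value for the full list, which reaches \<open>Q\<close>.\<close>
    with Cons.prems(3) have "\<pi>s \<noteq> []" by auto
    with Cons.IH[of "seen @ [\<pi>]"] Cons.prems orc False show ?thesis by simp
  qed
qed simp

text \<open>As \<open>qrse_plus\<close> is a relation, the first conjunct keeps the second from
  holding vacuously; the second covers every order of enumeration.\<close>

theorem proposition5p2:
  fixes P :: "('a, 'x, 's, 'l) program"
    and Tgt :: "'s list set"
    and k :: nat
    and Q :: real
    and orc :: "('a, 'x) robustness_oracle"
  assumes "det_program P"
    and "exact_oracle P Tgt orc"
    and "quant_robustness P (restrict_length P k) Tgt \<ge> Q"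
  shows "(\<exists>r. qrse_plus P orc k Tgt Q r) \<and>
    (\<forall>r. qrse_plus P orc k Tgt Q r \<longrightarrow>
       (\<exists>\<chi>. r = Robust \<chi> \<and> Q \<le> \<chi> \<and> \<chi> \<le> quant_robustness P (restrict_length P k) Tgt))"
proof (intro conjI allI impI)
  interpret det_program P by fact
  show "\<exists>r. qrse_plus P orc k Tgt Q r"
    using ex_enumerates_paths unfolding qrse_plus_def by blast
  fix r assume "qrse_plus P orc k Tgt Q r"
  then obtain \<pi>s where enum: "enumerates_paths P k \<pi>s"
    and r: "r = qrse_plus_loop P orc Tgt Q [] \<pi>s"
    unfolding qrse_plus_def by blast
  have set_\<pi>s: "set \<pi>s = {\<pi> \<in> paths P. num_trans \<pi> \<le> k}"
    using enum by (simp add: enumerates_paths_def)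
  have "Q \<le> quant_robustness P (restrict_paths P \<pi>s) Tgt"
    using assms(3) quant_robustness_mono[OF restrict_length_subset_restrict_paths[OF enum]]
    by (rule order_trans)
  then obtain ys where ys: "set ys \<subseteq> set \<pi>s"
      "Q \<le> quant_robustness P (restrict_paths P ys) Tgt"
      "r = Robust (quant_robustness P (restrict_paths P ys) Tgt)"
    using qrse_plus_loop_Robust[OF assms(2), of "[]" \<pi>s Q] enumeration_nonempty[OF enum] set_\<pi>s r
    by auto
  moreover have "quant_robustness P (restrict_paths P ys) Tgt
      \<le> quant_robustness P (restrict_length P k) Tgt"
    using ys(1) set_\<pi>s by (intro quant_robustness_mono restrict_paths_subset_restrict_length) auto
  ultimately show "\<exists>\<chi>. r = Robust \<chi> \<and> Q \<le> \<chi> \<and>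
      \<chi> \<le> quant_robustness P (restrict_length P k) Tgt"
    by blast
qed

end
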